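(* (a) Let $\mathcal{Y}$ and $\mathcal{Z}$ be Euclidean spaces, let $J:\mathcal{Z}\to\mathbb{R}$ be $\eta$-weakly convex with $\eta>0$, and let $\mathcal{F}:\mathcal{Y}\to\mathcal{Z}$ be continuously differentiable. Then for every $\bar{\bm{y}}\in\mathcal{Y}$, $$\mathop{\mathrm{Lim\,sup}}_{\mathbb{R}_{++}\ni\mu\searrow0,\ \mathcal{Y}\ni\bm{y}\to\bar{\bm{y}}}\nabla({}^{\mu}J\circ\mathcal{F})(\bm{y})\subset\partial_{\rm L}(J\circ\mathcal{F})(\bar{\bm{y}}).$$ (b) Let $\mathcal{X},\mathcal{Y},\mathcal{Z}$ be Euclidean spaces, let $\emptyset\neq C\subset\mathcal{X}$ be a connected closed embedded submanifold of $\mathcal{X}$, and let $F:=h+g\circ\mathfrak{S}:\mathcal{X}\to\mathbb{R}$ where: $h:\mathcal{X}\to\mathbb{R}$ is continuously differentiable with $\nabla h$ Lipschitz continuous over $C$ with constant $L_{\nabla h}>0$; $\mathfrak{S}:\mathcal{X}\to\mathcal{Z}$ is continuously differentiable; $g:\mathcal{Z}\to\mathbb{R}$ is Lipschitz continuous with constant $L_g>0$ and $\eta$-weakly convex with $\eta>0$; and $\inf_{\bm{x}\in C}F(\bm{x})>-\infty$. Let $\bm{\varphi}:\mathcal{Y}\to\mathcal{X}$ be continuously differentiable with $\bm{\varphi}(\mathcal{Y})=C$. For $\mu\in(0,\eta^{-1})$ let $F^{\langle\mu\rangle}:=h+{}^{\mu}g\circ\mathfrak{S}$. Then for every $\bar{\bm{y}}\in\mathcal{Y}$,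 $$\mathop{\mathrm{Lim\,sup}}_{\mathbb{R}_{++}\ni\mu\searrow0,\ \mathcal{Y}\ni\bm{y}\to\bar{\bm{y}}}\nabla(F^{\langle\mu\rangle}\circ\bm{\varphi})(\bm{y})\subset\partial_{\rm L}(F\circ\bm{\varphi})(\bar{\bm{y}}).$$ Moreover, if a sequence $(\bm{y}_n)_{n=1}^\infty\subset\mathcal{Y}$ converges to some $\bar{\bm{y}}\in\mathcal{Y}$, and $(\mu_n)_{n=1}^\infty\subset(0,\eta^{-1})$ satisfies $\mu_n\searrow0$, then $$d\left(\bm{0},\partial_{\rm L}(F\circ\bm{\varphi})(\bar{\bm{y}})\right)\le\liminf_{n\to\infty}\left\|\nabla(F^{\langle\mu_n\rangle}\circ\bm{\varphi})(\bm{y}_n)\right\|.$$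
   Context: A Euclidean space is a finite-dimensional real Hilbert space. $J$ is $\eta$-weakly convex if $J+\frac{\eta}{2}\|\cdot\|^2$ is convex. For $\mu\in(0,\eta^{-1})$, the Moreau envelope of an $\eta$-weakly convex $J:\mathcal{Z}\to\mathbb{R}$ is ${}^{\mu}J(\bar{\bm{z}}):=\inf_{\bm{z}\in\mathcal{Z}}\left(J(\bm{z})+\frac{1}{2\mu}\|\bm{z}-\bar{\bm{z}}\|^2\right)$; it is known to be continuously differentiable on $\mathcal{Z}$. $\mu_n\searrow0$ means the sequence is monotonically nonincreasing with limit $0$. $\mathbb{R}_{++}$ is the set of positive reals. For a family of single-valued maps $G_\mu:\mathcal{Y}\to\mathcal{Y}$ ($\mu\in(0,\eta^{-1})$), $\mathop{\mathrm{Lim\,sup}}_{\mathbb{R}_{++}\ni\mu\searrow0,\mathcal{Y}\ni\bm{y}\to\bar{\bm{y}}}G_\mu(\bm{y})$ is the set of all $\bm{v}\in\mathcal{Y}$ for which there exist $\bm{y}_n\to\bar{\bm{y}}$ and $(\mu_n)\subset(0,\eta^{-1})$ with $\mu_n\searrow0$ and $G_{\mu_n}(\bm{y}_n)\to\bm{v}$. $d(\bar{\bm{x}},E):=\inf\{\|\bm{v}-\bar{\bm{x}}\|\mid\bm{v}\in E\}$ if $E\neq\emptyset$, and $+\infty$ if $E=\emptyset$. Subdifferentials: for a function $J$ on a Euclidean space with values in $\mathbb{R}\cup\{+\infty\}$ and $\bar{\bm{x}}$ with $J(\bar{\bm{x}})<+\infty$, $\partial_{\rm F}J(\bar{\bm{x}}):=\{\bm{v}\mid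 \liminf_{\bm{x}\to\bar{\bm{x}},\bm{x}\neq\bar{\bm{x}}}\frac{J(\bm{x})-J(\bar{\bm{x}})-\langle\bm{v},\bm{x}-\bar{\bm{x}}\rangle}{\|\bm{x}-\bar{\bm{x}}\|}\ge0\}$, and the limiting subdifferential $\partial_{\rm L}J(\bar{\bm{x}})$ is the set of all $\bm{v}$ for which there exist $\bm{x}_n\to\bar{\bm{x}}$ with $J(\bm{x}_n)\to J(\bar{\bm{x}})$ and $\bm{v}_n\in\partial_{\rm F}J(\bm{x}_n)$ with $\bm{v}_n\to\bm{v}$. Embedded submanifold: $C\subset\mathcal{X}$ is a $d$-dimensional embedded submanifold if each $\bar{\bm{x}}\in C$ has an open neighborhood $\mathcal{N}_{\bar{\bm{x}}}\subset\mathcal{X}$ and a continuously differentiable $H_{\bar{\bm{x}}}:\mathcal{N}_{\bar{\bm{x}}}\to\mathbb{R}^{\dim(\mathcal{X})-d}$ with $C\cap\mathcal{N}_{\bar{\bm{x}}}=H_{\bar{\bm{x}}}^{-1}(\bm{0})$ and $\mathrm{Rank}(\mathrm{D}H_{\bar{\bm{x}}}(\bar{\bm{x}}))=\dim(\mathcal{X})-d$. *)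

theory Defs
  imports "HOL-Analysis.Analysis"
begin

text \<open>The Riesz representative of the Frechet derivative; unspecified where \<open>f\<close> is not differentiable.\<close>

definition gradient :: "('a::euclidean_space \<Rightarrow> real) \<Rightarrow> 'a \<Rightarrow> 'a" where
  "gradient f x = (THE D. GDERIV f x :> D)"

lemma gradient_eqI:
  assumes "GDERIV f x :> D"
  shows "gradient f x = D"
proof -
  have "D' = D" if "GDERIV f x :> D'" for D'
  proof -
    have "(\<lambda>h. h \<bullet> D') = (\<lambda>h. h \<bullet> D)"
      using has_derivative_unique[OF that[unfolded gderiv_def] assms[unfolded gderiv_def]] .
    then have "\<forall>h. h \<bullet> D' = h \<bullet> D"
      by (rule fun_cong[THEN allI])
    then show ?thesis
      by (simp only: vector_eq_ldot)
  qed
  with assms show ?thesis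
    unfolding gradient_def by (rule the_equality)
qed

text \<open>Intended for open \<open>S\<close>. Continuity of the derivative is with respect to the operator norm.\<close>

definition continuously_differentiable_on ::
    "'a::euclidean_space set \<Rightarrow> ('a \<Rightarrow> 'b::euclidean_space) \<Rightarrow> bool" where
  "continuously_differentiable_on S f \<longleftrightarrow>
     (\<exists>f' :: 'a \<Rightarrow> 'a \<Rightarrow>\<^sub>L 'b.
        (\<forall>x\<in>S. (f has_derivative blinfun_apply (f' x)) (at x)) \<and> continuous_on S f')"

definition weakly_convex :: "real \<Rightarrow> ('a::euclidean_space \<Rightarrow> real) \<Rightarrow> bool" where
  "weakly_convex \<eta> J \<longleftrightarrow> convex_on UNIV (\<lambda>x. J x + \<eta> / 2 * (norm x)\<^sup>2)"

text \<open>The infimum is taken in the reals. For an \<open>\<eta>\<close>-weakly convex \<open>J\<close> and \<open>0 < \<mu> < 1 / \<eta>\<close>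
  the objective is bounded below, so this is the true infimum.\<close>

definition moreau_envelope :: "real \<Rightarrow> ('a::euclidean_space \<Rightarrow> real) \<Rightarrow> 'a \<Rightarrow> real" where
  "moreau_envelope \<mu> J zbar = (INF z. J z + 1 / (2 * \<mu>) * (norm (z - zbar))\<^sup>2)"

definition smoothing_parameters :: "real \<Rightarrow> (nat \<Rightarrow> real) \<Rightarrow> bool" where
  "smoothing_parameters \<eta> \<mu> \<longleftrightarrow>
     (\<forall>n. 0 < \<mu> n \<and> \<mu> n < inverse \<eta>) \<and> decseq \<mu> \<and> \<mu> \<longlonglongrightarrow> 0"

text \<open>The outer limit of \<open>G \<mu> y\<close> as \<open>\<mu>\<close> decreases to \<open>0\<close> within \<open>(0, 1 / \<eta>)\<close> and \<open>y\<close> tends to \<open>ybar\<close>.\<close>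

definition outer_limit ::
    "real \<Rightarrow> (real \<Rightarrow> 'a \<Rightarrow> 'a) \<Rightarrow> 'a::euclidean_space \<Rightarrow> 'a set" where
  "outer_limit \<eta> G ybar =
     {v. \<exists>y \<mu>. y \<longlonglongrightarrow> ybar \<and> smoothing_parameters \<eta> \<mu> \<and> (\<lambda>n. G (\<mu> n) (y n)) \<longlonglongrightarrow> v}"

text \<open>Both subdifferentials are empty at points where \<open>J\<close> is not finite. The punctured filter
  \<open>at x\<close> encodes \<open>x' \<noteq> x\<close>.\<close>

definition frechet_subdifferential :: "('a::euclidean_space \<Rightarrow> ereal) \<Rightarrow> 'a \<Rightarrow> 'a set" where
  "frechet_subdifferential J x =
     {v. \<bar>J x\<bar> \<noteq> \<infinity> \<and>
         0 \<le> Liminf (at x) (\<lambda>x'. (J x' - J x - ereal (v \<bullet> (x' - x))) / ereal (norm (x' - x)))}"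

definition limiting_subdifferential :: "('a::euclidean_space \<Rightarrow> ereal) \<Rightarrow> 'a \<Rightarrow> 'a set" where
  "limiting_subdifferential J xbar =
     {v. \<bar>J xbar\<bar> \<noteq> \<infinity> \<and>
         (\<exists>x w. x \<longlonglongrightarrow> xbar \<and> (\<lambda>n. J (x n)) \<longlonglongrightarrow> J xbar \<and>
                (\<forall>n. w n \<in> frechet_subdifferential J (x n)) \<and> w \<longlonglongrightarrow> v)}"

text \<open>Since the infimum is taken in the extended reals, the distance to the empty set is
  \<open>\<infinity>\<close> (in contrast to \<open>infdist\<close>).\<close>

definition ext_dist :: "'a::euclidean_space \<Rightarrow> 'a set \<Rightarrow> ereal" where
  "ext_dist x E = (INF v\<in>E. ereal (norm (v - x)))"

text \<open>The codomain of the local defining map \<open>H\<close>, a Euclidean space of dimension \<open>DIM('a) - d\<close>, is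
  realised as a linear subspace \<open>E\<close> of that dimension; this also covers \<open>d = DIM('a)\<close>, for
  which no type of class \<open>euclidean_space\<close> would be available.\<close>

definition embedded_submanifold :: "nat \<Rightarrow> 'a::euclidean_space set \<Rightarrow> bool" where
  "embedded_submanifold d C \<longleftrightarrow>
     d \<le> DIM('a) \<and>
     (\<forall>x\<in>C. \<exists>N E (H :: 'a \<Rightarrow> 'a).
        open N \<and> x \<in> N \<and>
        subspace E \<and> dim E = DIM('a) - d \<and> H ` N \<subseteq> E \<and>
        continuously_differentiable_on N H \<and>
        C \<inter> N = {u \<in> N. H u = 0} \<and>
        dim (range (frechet_derivative H (at x))) = DIM('a) - d)"

end

theory Submission
  imports Defs
begin

text \<open>The gradient of the Moreau envelope of \<open>J\<close> at \<open>z\<close> is \<open>(z - p) /\<^sub>R \<mu>\<close>, where \<open>p\<close> minimises the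
  objective, and weak convexity makes it a proximal subgradient of \<open>J\<close> at \<open>p\<close>:
  a global quadratic minorant touches \<open>J\<close> at \<open>p\<close>. When \<open>\<mu>\<close> tends to \<open>0\<close> and \<open>z\<close> converges, \<open>p\<close> has
  the same limit as \<open>z\<close>, and the subgradients stay bounded because \<open>J\<close> is locally bounded. A cluster
  point \<open>w\<close> is again a proximal subgradient. Composing its quadratic minorant with a
  \<open>C\<^sup>1\<close> map \<open>G\<close> gives a differentiable minorant of \<open>J \<circ> G\<close>
  whose gradient is the adjoint of the derivative of \<open>G\<close> applied to \<open>w\<close>; it is therefore even a
  Frechet subgradient. Both inclusions and the distance bound follow by passing to subsequences.\<close>

section \<open>Proximal subgradients and proximal points\<close>

text \<open>The minorant is global and its curvature is the fixed \<open>\<eta>\<close>. For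
  continuous \<open>J\<close> this is a family of non-strict inequalities that survives limits in
  \<open>p\<close> and \<open>w\<close>.\<close>

definition proximal_subgradient :: "real \<Rightarrow> ('a::euclidean_space \<Rightarrow> real) \<Rightarrow> 'a \<Rightarrow> 'a \<Rightarrow> bool" where
  "proximal_subgradient \<eta> J p w \<longleftrightarrow> (\<forall>x. J p + w \<bullet> (x - p) - \<eta> / 2 * (norm (x - p))\<^sup>2 \<le> J x)"

definition prox_point :: "real \<Rightarrow> ('a::euclidean_space \<Rightarrow> real) \<Rightarrow> 'a \<Rightarrow> 'a \<Rightarrow> bool" where
  "prox_point \<mu> J z p \<longleftrightarrow>
     (\<forall>x. J p + 1 / (2 * \<mu>) * (norm (p - z))\<^sup>2 \<le> J x + 1 / (2 * \<mu>) * (norm (x - z))\<^sup>2)"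

section \<open>Estimates from weak convexity\<close>

lemma weakly_convex_continuous:
  assumes "weakly_convex \<eta> J"
  shows "continuous_on UNIV J"
proof -
  have "continuous_on UNIV (\<lambda>x. J x + \<eta> / 2 * (norm x)\<^sup>2)"
    using assms convex_on_continuous[of UNIV] by (simp add: weakly_convex_def)
  then have "continuous_on UNIV (\<lambda>x. (J x + \<eta> / 2 * (norm x)\<^sup>2) - \<eta> / 2 * (norm x)\<^sup>2)"
    by (rule continuous_on_diff) (intro continuous_intros)
  then show ?thesis by simp
qed

text \<open>In the convexity inequality for \<open>J\<close> plus the quadratic, the squared norms
  cancel except for the defect \<open>t * (1 - t) * (norm (x - p))\<^sup>2\<close>.\<close>

lemma weakly_convex_segment:
  assumes "weakly_convex \<eta> J" "0 \<le> t" "t \<le> 1"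
  shows "J (p + t *\<^sub>R (x - p)) \<le> (1 - t) * J p + t * J x + \<eta> / 2 * t * (1 - t) * (norm (x - p))\<^sup>2"
proof -
  have eq: "p + t *\<^sub>R (x - p) = (1 - t) *\<^sub>R p + t *\<^sub>R x"
    by (simp add: algebra_simps)
  have "J (p + t *\<^sub>R (x - p)) + \<eta> / 2 * (norm (p + t *\<^sub>R (x - p)))\<^sup>2
      \<le> (1 - t) * (J p + \<eta> / 2 * (norm p)\<^sup>2) + t * (J x + \<eta> / 2 * (norm x)\<^sup>2)"
    using convex_onD[OF assms(1)[unfolded weakly_convex_def], of t p x] assms(2,3)
    unfolding eq by simp
  moreover have "(norm (p + t *\<^sub>R (x - p)))\<^sup>2
      = (1 - t) * (norm p)\<^sup>2 + t * (norm x)\<^sup>2 - t * (1 - t) * (norm (x - p))\<^sup>2"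
    unfolding power2_norm_eq_inner
    by (simp add: inner_simps inner_commute algebra_simps power2_eq_square)
  ultimately have "J (p + t *\<^sub>R (x - p))
      + \<eta> / 2 * ((1 - t) * (norm p)\<^sup>2 + t * (norm x)\<^sup>2 - t * (1 - t) * (norm (x - p))\<^sup>2)
      \<le> (1 - t) * (J p + \<eta> / 2 * (norm p)\<^sup>2) + t * (J x + \<eta> / 2 * (norm x)\<^sup>2)"
    by (simp only:)
  then show ?thesis
    by (simp add: field_simps)
qed

text \<open>Near \<open>c\<close>, compactness bounds \<open>J\<close>. For distant
  \<open>x\<close>, the segment from \<open>c\<close> to \<open>x\<close> meets the unit sphere
  around \<open>c\<close>, where \<open>J\<close> is at least \<open>- B\<close>; the segment
  inequality there is solved for \<open>J x\<close>. The quadratic coefficient stays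
  \<open>\<eta> / 2\<close>, which \<open>1 / (2 * \<mu>)\<close> exceeds for admissible
  \<mu>.\<close>

lemma weakly_convex_lower_bound:
  assumes wc: "weakly_convex \<eta> J" and "\<eta> > 0"
  obtains M where "M \<ge> 0"
    "\<And>x. J c - M * (1 + norm (x - c)) - \<eta> / 2 * (norm (x - c))\<^sup>2 \<le> J x"
proof -
  have "compact (J ` cball c 1)"
    by (intro compact_continuous_image continuous_on_subset[OF weakly_convex_continuous[OF wc]]) auto
  then obtain B where B: "\<And>x. x \<in> cball c 1 \<Longrightarrow> \<bar>J x\<bar> \<le> B"
    using compact_imp_bounded bounded_iff by (metis image_eqI real_norm_def)
  \<comment> \<open>\<open>2 * B\<close> bounds the oscillation of \<open>J\<close> on the unit
    ball, and \<open>2 * B * r\<close> absorbs \<open>r * J c + r * B\<close> at distance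
    \<open>r > 1\<close>.\<close>
  define M where "M = 2 * B + \<eta> / 2"
  have B0: "\<bar>J c\<bar> \<le> B" by (rule B) simp
  have M0: "M \<ge> 0" using B0 \<open>\<eta> > 0\<close> by (auto simp: M_def)
  have "J c - M * (1 + norm (x - c)) - \<eta> / 2 * (norm (x - c))\<^sup>2 \<le> J x" for x
  proof (cases "norm (x - c) \<le> 1")
    case True
    then have "\<bar>J x\<bar> \<le> B"
      by (intro B) (simp add: dist_norm norm_minus_commute)
    moreover have "M * 1 \<le> M * (1 + norm (x - c))"
      using M0 by (intro mult_left_mono) auto
    moreover have "0 \<le> \<eta> / 2 * (norm (x - c))\<^sup>2" using \<open>\<eta> > 0\<close> by simp
    moreover have "2 * B \<le> M" using \<open>\<eta> > 0\<close> by (simp add: M_def)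
    ultimately show ?thesis using B0 by linarith
  next
    case False
    define r where "r = norm (x - c)"
    have r: "r > 1" using False by (simp add: r_def)
    have "\<bar>J (c + (1 / r) *\<^sub>R (x - c))\<bar> \<le> B"
      using r by (intro B) (simp add: dist_norm r_def)
    moreover have "J (c + (1 / r) *\<^sub>R (x - c))
        \<le> (1 - 1 / r) * J c + 1 / r * J x + \<eta> / 2 * (1 / r) * (1 - 1 / r) * r\<^sup>2"
      using weakly_convex_segment[OF wc, of "1 / r" c x] r unfolding r_def[symmetric] by simp
    ultimately have "r * (- B) \<le> r * ((1 - 1 / r) * J c + 1 / r * J x + \<eta> / 2 * (1 / r) * (1 - 1 / r) * r\<^sup>2)"
      using r by (intro mult_left_mono) auto
    also have "\<dots> = (r - 1) * J c + J x + \<eta> / 2 * (r - 1) * r"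
      using r by (simp add: field_simps power2_eq_square)
    finally have "J c - r * J c - r * B - \<eta> / 2 * r\<^sup>2 + \<eta> / 2 * r \<le> J x"
      by (simp add: field_simps power2_eq_square)
    moreover have "r * J c \<le> r * B" using B0 r by (intro mult_left_mono) auto
    moreover have "0 \<le> \<eta> / 2 * r" using r \<open>\<eta> > 0\<close> by simp
    moreover have "M * (1 + r) = (2 * B + \<eta> / 2) + 2 * (r * B) + \<eta> / 2 * r"
      by (simp add: M_def field_simps)
    ultimately show ?thesis
      using M0 unfolding r_def[symmetric] by (simp add: M_def)
  qed
  with M0 show thesis by (rule that)
qed

section \<open>Proximal points: existence and the subgradients they carry\<close>

text \<open>The objective is coercive: outside a large ball it is at least its value at
  \<open>z\<close>, so a minimiser over the ball is global.\<close>

lemma prox_point_exists: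
  assumes wc: "weakly_convex \<eta> J" and \<eta>: "\<eta> > 0" and \<mu>: "0 < \<mu>" "\<mu> < inverse \<eta>"
  obtains p where "prox_point \<mu> J z p"
proof -
  obtain M where M: "M \<ge> 0"
      "\<And>x. J z - M * (1 + norm (x - z)) - \<eta> / 2 * (norm (x - z))\<^sup>2 \<le> J x"
    using weakly_convex_lower_bound[OF wc \<eta>, of z] by metis
  define c where "c = 1 / (2 * \<mu>) - \<eta> / 2"
  have c: "c > 0" using \<mu> \<eta> by (simp add: c_def field_simps)
  \<comment> \<open>For \<open>r > R\<close> this gives
    \<open>M * (1 + r) \<le> 2 * M * r \<le> c * r * r\<close>, so the quadratic surplus beats the
    linear loss.\<close>
  define R where "R = max 1 (2 * M / c)"
  define Q where "Q = (\<lambda>x. J x + 1 / (2 * \<mu>) * (norm (x - z))\<^sup>2)"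
  have "continuous_on (cball z R) Q"
    unfolding Q_def
    by (intro continuous_intros continuous_on_subset[OF weakly_convex_continuous[OF wc]]) auto
  moreover have "z \<in> cball z R" by (simp add: R_def)
  ultimately obtain p where p: "p \<in> cball z R" "\<And>x. x \<in> cball z R \<Longrightarrow> Q p \<le> Q x"
    using continuous_attains_inf[of "cball z R" Q] by (metis compact_cball empty_iff)
  have "Q p \<le> Q x" for x
  proof (cases "x \<in> cball z R")
    case False
    define r where "r = norm (x - z)"
    have r: "r > 1" "r > 2 * M / c"
      using False by (auto simp: R_def r_def dist_norm norm_minus_commute)
    have "M * (1 + r) \<le> 2 * M * r" using mult_left_mono[of 1 r M] r M(1) by (simp add: algebra_simps)
    also have "\<dots> \<le> c * r * r" using r c by (intro mult_right_mono) (auto simp: field_simps)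
    finally have "J z \<le> Q x"
      using M(2)[of x] unfolding Q_def c_def r_def[symmetric]
      by (simp add: algebra_simps power2_eq_square)
    moreover have "Q p \<le> Q z" by (rule p(2)) fact
    ultimately show ?thesis by (simp add: Q_def)
  qed (rule p(2))
  then show thesis by (intro that[of p]) (simp add: prox_point_def Q_def)
qed

text \<open>Compare \<open>p\<close> with \<open>p + t *\<^sub>R (x - p)\<close>, divide by
  \<open>t\<close> and let \<open>t\<close> tend to 0. The share of \<mu> in the curvature vanishes
  in this limit, so the minorant has curvature \<eta> whatever \<mu> is.\<close>

lemma prox_point_subgradient:
  assumes wc: "weakly_convex \<eta> J" and \<mu>: "0 < \<mu>" and p: "prox_point \<mu> J z p"
  shows "proximal_subgradient \<eta> J p ((z - p) /\<^sub>R \<mu>)"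
  unfolding proximal_subgradient_def
proof
  fix x
  define w where "w = (z - p) /\<^sub>R \<mu>"
  define D where "D = (norm (x - p))\<^sup>2"
  have *: "w \<bullet> (x - p) \<le> J x - J p + (\<eta> / 2 * (1 - t) + t / (2 * \<mu>)) * D" if t: "0 < t" "t < 1" for t
  proof -
    have "J p + 1 / (2 * \<mu>) * (norm (p - z))\<^sup>2
        \<le> J (p + t *\<^sub>R (x - p)) + 1 / (2 * \<mu>) * (norm (p + t *\<^sub>R (x - p) - z))\<^sup>2"
      using p by (simp add: prox_point_def)
    moreover have "J (p + t *\<^sub>R (x - p)) \<le> (1 - t) * J p + t * J x + \<eta> / 2 * t * (1 - t) * D"
      unfolding D_def using t by (intro weakly_convex_segment[OF wc]) auto
    moreover have "(norm (p + t *\<^sub>R (x - p) - z))\<^sup>2 = (norm (p - z))\<^sup>2 - 2 * \<mu> * t * (w \<bullet> (x - p)) + t\<^sup>2 * D"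
    proof -
      have "z - p = \<mu> *\<^sub>R w" using \<mu> by (simp add: w_def)
      then have "p + t *\<^sub>R (x - p) - z = t *\<^sub>R (x - p) - \<mu> *\<^sub>R w" and "p - z = - (\<mu> *\<^sub>R w)"
        by (simp_all add: algebra_simps)
      moreover have "(norm (t *\<^sub>R u - \<mu> *\<^sub>R w))\<^sup>2
          = (norm (- (\<mu> *\<^sub>R w)))\<^sup>2 - 2 * \<mu> * t * (w \<bullet> u) + t\<^sup>2 * (norm u)\<^sup>2" for u
        unfolding power2_norm_eq_inner
        by (simp add: inner_diff inner_commute power2_eq_square algebra_simps)
      ultimately show ?thesis by (simp only: D_def)
    qed
    then have "1 / (2 * \<mu>) * (norm (p + t *\<^sub>R (x - p) - z))\<^sup>2
        = 1 / (2 * \<mu>) * (norm (p - z))\<^sup>2 - t * (w \<bullet> (x - p)) + t * (t / (2 * \<mu>) * D)"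
      using \<mu> by (simp add: field_simps power2_eq_square)
    ultimately have "t * (w \<bullet> (x - p))
        \<le> (1 - t) * J p + t * J x + \<eta> / 2 * t * (1 - t) * D - J p + t * (t / (2 * \<mu>) * D)"
      by linarith
    also have "\<dots> = t * (J x - J p + (\<eta> / 2 * (1 - t) + t / (2 * \<mu>)) * D)"
      by (simp add: algebra_simps)
    finally have "t * (w \<bullet> (x - p)) \<le> t * (J x - J p + (\<eta> / 2 * (1 - t) + t / (2 * \<mu>)) * D)" .
    then show ?thesis using t by simp
  qed
  have "((\<lambda>t. J x - J p + (\<eta> / 2 * (1 - t) + t / (2 * \<mu>)) * D)
      \<longlongrightarrow> J x - J p + (\<eta> / 2 * (1 - 0) + 0 / (2 * \<mu>)) * D) (at_right 0)"
    using \<mu> by (intro tendsto_intros) auto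
  then have "w \<bullet> (x - p) \<le> J x - J p + (\<eta> / 2 * (1 - 0) + 0 / (2 * \<mu>)) * D"
    by (rule tendsto_lowerbound) (use * in \<open>auto simp: eventually_at_right[of 0 1] intro!: exI[of _ 1]\<close>)
  then show "J p + ((z - p) /\<^sub>R \<mu>) \<bullet> (x - p) - \<eta> / 2 * (norm (x - p))\<^sup>2 \<le> J x"
    by (simp add: w_def D_def)
qed

section \<open>Differentiability of the Moreau envelope\<close>

lemma has_derivative_quadratic_error:
  fixes f :: "'a::euclidean_space \<Rightarrow> real"
  assumes "\<And>y. \<bar>f y - f x - w \<bullet> (y - x)\<bar> \<le> c * (norm (y - x))\<^sup>2"
  shows "(f has_derivative (\<lambda>d. w \<bullet> d)) (at x)"
proof -
  have "((\<lambda>y. norm (f y - f x - w \<bullet> (y - x)) / norm (y - x)) \<longlongrightarrow> 0) (at x)"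
  proof (rule Lim_null_comparison)
    show "\<forall>\<^sub>F y in at x. norm (norm (f y - f x - w \<bullet> (y - x)) / norm (y - x)) \<le> c * norm (y - x)"
      unfolding eventually_at_filter
      using assms by (auto intro!: always_eventually simp: divide_le_eq power2_eq_square mult.assoc)
    have "((\<lambda>y. c * norm (y - x)) \<longlongrightarrow> c * norm (x - x)) (at x)"
      by (intro tendsto_intros)
    then show "((\<lambda>y. c * norm (y - x)) \<longlongrightarrow> 0) (at x)" by simp
  qed
  then show ?thesis
    by (auto simp: has_derivative_iff_norm intro: bounded_linear_inner_right)
qed

text \<open>The envelope lies between two quadratics that touch it at \<open>z\<close> with the same
  slope \<open>w\<close>. The upper one comes from using \<open>p\<close> as a competitor at
  \<open>z'\<close>, the lower one from the proximal subgradient inequality at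
  \<open>p\<close>.\<close>

lemma moreau_envelope_has_derivative:
  assumes wc: "weakly_convex \<eta> J" and \<eta>: "\<eta> > 0" and \<mu>: "0 < \<mu>" "\<mu> < inverse \<eta>"
    and p: "prox_point \<mu> J z p"
  shows "(moreau_envelope \<mu> J has_derivative (\<lambda>d. ((z - p) /\<^sub>R \<mu>) \<bullet> d)) (at z)"
proof -
  define w where "w = (z - p) /\<^sub>R \<mu>"
  have zp: "z - p = \<mu> *\<^sub>R w" using \<mu> by (simp add: w_def)
  let ?e = "moreau_envelope \<mu> J"
  \<comment> \<open>A real infimum can be compared with its members only when the set is bounded
    below; a proximal point at \<open>z'\<close> supplies the bound.\<close>
  have bdd: "bdd_below (range (\<lambda>x. J x + 1 / (2 * \<mu>) * (norm (x - z'))\<^sup>2))" for z'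
  proof -
    obtain q where "prox_point \<mu> J z' q" using prox_point_exists[OF wc \<eta> \<mu>] .
    then show ?thesis unfolding prox_point_def by (intro bdd_belowI) auto
  qed
  have ez: "?e z = J p + 1 / (2 * \<mu>) * (norm (p - z))\<^sup>2"
    unfolding moreau_envelope_def
  proof (rule antisym)
    show "(INF x. J x + 1 / (2 * \<mu>) * (norm (x - z))\<^sup>2) \<le> J p + 1 / (2 * \<mu>) * (norm (p - z))\<^sup>2"
      by (rule cINF_lower[OF bdd]) simp
    show "J p + 1 / (2 * \<mu>) * (norm (p - z))\<^sup>2 \<le> (INF x. J x + 1 / (2 * \<mu>) * (norm (x - z))\<^sup>2)"
      using p by (intro cINF_greatest) (auto simp: prox_point_def)
  qed
  \<comment> \<open>\<open>- c * (norm b)\<^sup>2\<close> is the minimum over \<open>a\<close> of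
    \<open>1 / (2 * \<mu>) * (norm (a - b))\<^sup>2 - \<eta> / 2 * (norm a)\<^sup>2\<close>,
    attained where \<open>(1 - \<eta> * \<mu>) *\<^sub>R a = b\<close>.\<close>
  define c where "c = \<eta> / (2 * (1 - \<eta> * \<mu>))"
  have pos: "0 < 1 - \<eta> * \<mu>" using \<mu> \<eta> by (simp add: field_simps)
  have upper: "?e z' - ?e z - w \<bullet> (z' - z) \<le> 1 / (2 * \<mu>) * (norm (z' - z))\<^sup>2" for z'
  proof -
    have "?e z' \<le> J p + 1 / (2 * \<mu>) * (norm (p - z'))\<^sup>2"
      unfolding moreau_envelope_def by (rule cINF_lower[OF bdd]) simp
    moreover have "(norm (p - z'))\<^sup>2 = (norm (p - z))\<^sup>2 + 2 * \<mu> * (w \<bullet> (z' - z)) + (norm (z' - z))\<^sup>2"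
    proof -
      have "p - z' = - (\<mu> *\<^sub>R w) - (z' - z)" "p - z = - (\<mu> *\<^sub>R w)"
        using zp by (simp_all add: algebra_simps)
      moreover have "(norm (- (\<mu> *\<^sub>R w) - b))\<^sup>2 = (norm (- (\<mu> *\<^sub>R w)))\<^sup>2 + 2 * \<mu> * (w \<bullet> b) + (norm b)\<^sup>2" for b
        unfolding power2_norm_eq_inner by (simp add: inner_diff inner_commute)
      ultimately show ?thesis by (simp only:)
    qed
    ultimately show ?thesis using ez \<mu> by (simp add: field_simps)
  qed
  have quad: "- c * (norm b)\<^sup>2 \<le> 1 / (2 * \<mu>) * (norm (a - b))\<^sup>2 - \<eta> / 2 * (norm a)\<^sup>2" for a b :: 'a
  proof -
    have "0 \<le> (norm ((1 - \<eta> * \<mu>) *\<^sub>R a - b))\<^sup>2 / (2 * \<mu> * (1 - \<eta> * \<mu>))"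
      using pos \<mu> by simp
    also have "\<dots> = 1 / (2 * \<mu>) * (norm (a - b))\<^sup>2 - \<eta> / 2 * (norm a)\<^sup>2 + c * (norm b)\<^sup>2"
    proof -
      define A where "A = a \<bullet> a"
      define B where "B = b \<bullet> b"
      define E where "E = a \<bullet> b"
      define s where "s = 1 - \<eta> * \<mu>"
      have s: "s \<noteq> 0" "\<eta> = (1 - s) / \<mu>" using pos \<mu> by (simp_all add: s_def)
      have "(norm (s *\<^sub>R a - b))\<^sup>2 = s\<^sup>2 * A - 2 * s * E + B" "(norm (a - b))\<^sup>2 = A - 2 * E + B"
        "(norm a)\<^sup>2 = A" "(norm b)\<^sup>2 = B"
        unfolding power2_norm_eq_inner A_def B_def E_def
        by (simp_all add: inner_diff inner_commute power2_eq_square)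
      moreover have "(s\<^sup>2 * A - 2 * s * E + B) / (2 * \<mu> * s)
          = 1 / (2 * \<mu>) * (A - 2 * E + B) - \<eta> / 2 * A + \<eta> / (2 * s) * B"
        unfolding s(2) using s(1) \<mu>(1) by (simp add: field_simps power2_eq_square)
      ultimately show ?thesis by (simp only: c_def s_def[symmetric])
    qed
    finally show ?thesis by simp
  qed
  have lower: "- c * (norm (z' - z))\<^sup>2 \<le> ?e z' - ?e z - w \<bullet> (z' - z)" for z'
  proof -
    \<comment> \<open>Expanding around \<open>p\<close> and \<open>z\<close> makes the terms
      \<open>w \<bullet> (x - p)\<close> cancel; \<open>quad\<close> with \<open>a = x - p\<close>
      and \<open>b = z' - z\<close> handles the rest.\<close>
    have "?e z + w \<bullet> (z' - z) - c * (norm (z' - z))\<^sup>2 \<le> J x + 1 / (2 * \<mu>) * (norm (x - z'))\<^sup>2" for x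
    proof -
      have "J p + w \<bullet> (x - p) - \<eta> / 2 * (norm (x - p))\<^sup>2 \<le> J x"
        using prox_point_subgradient[OF wc \<mu>(1) p] unfolding proximal_subgradient_def w_def by blast
      moreover have "(norm (x - z'))\<^sup>2
          = (norm (p - z))\<^sup>2 - 2 * \<mu> * (w \<bullet> (x - p) - w \<bullet> (z' - z)) + (norm ((x - p) - (z' - z)))\<^sup>2"
      proof -
        have "x - z' = ((x - p) - (z' - z)) - \<mu> *\<^sub>R w" "p - z = - (\<mu> *\<^sub>R w)"
          using zp by (simp_all add: algebra_simps)
        then show ?thesis
          unfolding power2_norm_eq_inner
          by (simp only: inner_diff inner_minus_left inner_minus_right inner_scaleR_left inner_scaleR_right)
            (simp add: inner_commute algebra_simps)
      qed
      then have "1 / (2 * \<mu>) * (norm (x - z'))\<^sup>2 = 1 / (2 * \<mu>) * (norm (p - z))\<^sup>2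
          - (w \<bullet> (x - p) - w \<bullet> (z' - z)) + 1 / (2 * \<mu>) * (norm ((x - p) - (z' - z)))\<^sup>2"
        using \<mu>(1) by (simp add: field_simps)
      ultimately show ?thesis using quad[of "z' - z" "x - p"] ez by linarith
    qed
    then have "?e z + w \<bullet> (z' - z) - c * (norm (z' - z))\<^sup>2 \<le> ?e z'"
      unfolding moreau_envelope_def[of _ _ z'] by (intro cINF_greatest) auto
    then show ?thesis by simp
  qed
  have "\<bar>?e z' - ?e z - w \<bullet> (z' - z)\<bar> \<le> (c + 1 / (2 * \<mu>)) * (norm (z' - z))\<^sup>2" for z'
  proof -
    have "0 \<le> c * (norm (z' - z))\<^sup>2" "0 \<le> 1 / (2 * \<mu>) * (norm (z' - z))\<^sup>2"
      using \<mu> \<eta> pos by (simp_all add: c_def)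
    then show ?thesis
      using upper[of z'] lower[of z'] unfolding distrib_right by linarith
  qed
  then show ?thesis
    unfolding w_def by (rule has_derivative_quadratic_error)
qed

section \<open>Limits of proximal points and bounds on subgradients\<close>

text \<open>With \<open>z n\<close> as competitor,
  \<open>(norm (p n - z n))\<^sup>2 / (2 * \<mu> n)\<close> is at most
  \<open>J (z n) - J (p n)\<close>, which grows at most quadratically in the same distance. For
  small \<mu> that growth is absorbed, so the squared distance is of order \<mu>.\<close>

lemma prox_points_converge:
  assumes wc: "weakly_convex \<eta> J" and \<eta>: "\<eta> > 0"
    and \<mu>: "\<And>n. 0 < \<mu> n" "\<mu> \<longlonglongrightarrow> 0" and z: "z \<longlonglongrightarrow> c"
    and p: "\<And>n. prox_point (\<mu> n) J (z n) (p n)"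
  shows "p \<longlonglongrightarrow> c"
proof -
  obtain M where M: "M \<ge> 0"
      "\<And>x. J c - M * (1 + norm (x - c)) - \<eta> / 2 * (norm (x - c))\<^sup>2 \<le> J x"
    using weakly_convex_lower_bound[OF wc \<eta>, of c] by metis
  \<comment> \<open>The summands come from \<open>J (z n) < J c + 1\<close>, from
    \<open>M * (1 + norm (p n - c)) \<le> M * (3 + r\<^sup>2)\<close> and from \<open>\<eta> / 2 *
    (norm (p n - c))\<^sup>2 \<le> \<eta> * (r\<^sup>2 + 1)\<close>.\<close>
  define K where "K = 1 + 3 * M + \<eta>"
  have "isCont J c"
    using weakly_convex_continuous[OF wc] by (simp add: continuous_on_eq_continuous_at)
  then have "(\<lambda>n. J (z n)) \<longlonglongrightarrow> J c" using z by (rule isCont_tendsto_compose)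
  then have "\<forall>\<^sub>F n in sequentially. J (z n) < J c + 1" by (rule order_tendstoD) simp
  moreover have "\<forall>\<^sub>F n in sequentially. dist (z n) c < 1" using z by (rule tendstoD) simp
  moreover have "(\<lambda>n. 2 * \<mu> n * (M + \<eta>)) \<longlonglongrightarrow> 2 * 0 * (M + \<eta>)" by (intro tendsto_intros \<mu>)
  \<comment> \<open>The threshold 1/2 lets half of \<open>r\<^sup>2\<close> be moved to the left,
    which doubles \<open>2 * K * \<mu> n\<close>.\<close>
  then have "\<forall>\<^sub>F n in sequentially. 2 * \<mu> n * (M + \<eta>) < 1 / 2" by (rule order_tendstoD) simp
  ultimately have ev: "\<forall>\<^sub>F n in sequentially. (norm (p n - z n))\<^sup>2 \<le> 4 * K * \<mu> n"
  proof eventually_elim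
    case (elim n)
    define r where "r = norm (p n - z n)"
    have "norm (p n - c) \<le> r + 1"
      using norm_triangle_ineq[of "p n - z n" "z n - c"] elim(2) by (simp add: r_def dist_norm)
    moreover have "r \<le> 1 + r\<^sup>2"
      using sum_squares_bound[of r 1] by (smt (verit) zero_le_power2 r_def norm_ge_zero power_one mult.right_neutral)
    ultimately have np: "norm (p n - c) \<le> 2 + r\<^sup>2" by simp
    have "(norm (p n - c))\<^sup>2 \<le> (r + 1)\<^sup>2"
      using \<open>norm (p n - c) \<le> r + 1\<close> by (intro power_mono) auto
    also have "\<dots> \<le> 2 * r\<^sup>2 + 2" using sum_squares_bound[of r 1] by (simp add: power2_sum)
    finally have np2: "\<eta> / 2 * (norm (p n - c))\<^sup>2 \<le> \<eta> * (r\<^sup>2 + 1)"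
      using \<eta> mult_left_mono[of _ _ "\<eta> / 2"] by (fastforce simp: algebra_simps)
    have "M * (1 + norm (p n - c)) \<le> M * (3 + r\<^sup>2)" using np M(1) by (intro mult_left_mono) auto
    moreover have "J (p n) + 1 / (2 * \<mu> n) * r\<^sup>2 \<le> J (z n)"
      using p[of n] unfolding prox_point_def r_def by (auto dest: spec[of _ "z n"])
    ultimately have "1 / (2 * \<mu> n) * r\<^sup>2 \<le> K + (M + \<eta>) * r\<^sup>2"
      using M(2)[of "p n"] np2 elim(1) unfolding K_def by (simp add: algebra_simps)
    then have "r\<^sup>2 \<le> 2 * \<mu> n * K + 2 * \<mu> n * (M + \<eta>) * r\<^sup>2"
      using \<mu>(1)[of n] by (simp add: field_simps)
    moreover have "2 * \<mu> n * (M + \<eta>) * r\<^sup>2 \<le> 1 / 2 * r\<^sup>2" using elim(3) by (intro mult_right_mono) auto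
    ultimately show ?case unfolding r_def[symmetric] by (simp add: algebra_simps)
  qed
  have "(\<lambda>n. 4 * K * \<mu> n) \<longlonglongrightarrow> 4 * K * 0" by (intro tendsto_intros \<mu>)
  then have "(\<lambda>n. 4 * K * \<mu> n) \<longlonglongrightarrow> 0" by simp
  moreover have "\<forall>\<^sub>F n in sequentially. norm ((norm (p n - z n))\<^sup>2) \<le> 4 * K * \<mu> n"
    using ev by simp
  ultimately have "(\<lambda>n. (norm (p n - z n))\<^sup>2) \<longlonglongrightarrow> 0"
    by (rule Lim_null_comparison[rotated])
  then have "(\<lambda>n. p n - z n) \<longlonglongrightarrow> 0"
    by (simp add: tendsto_norm_zero_iff)
  then have "(\<lambda>n. (p n - z n) + z n) \<longlonglongrightarrow> 0 + c" using z by (intro tendsto_add)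
  then show ?thesis by simp
qed

text \<open>A unit step from \<open>p n\<close> in the direction of \<open>w n\<close> turns the
  minorant into a bound on \<open>norm (w n)\<close> by the oscillation of \<open>J\<close> on a
  fixed ball plus \<open>\<eta> / 2\<close>.\<close>

lemma proximal_subgradients_bounded:
  assumes wc: "weakly_convex \<eta> J" and p: "p \<longlonglongrightarrow> c" and w: "\<And>n. proximal_subgradient \<eta> J (p n) (w n)"
  shows "bounded (range w)"
proof -
  obtain R where R: "\<And>n. norm (p n) \<le> R"
    using convergent_imp_bounded[OF p] by (auto simp: bounded_iff)
  have "compact (J ` cball 0 (R + 1))"
    by (intro compact_continuous_image continuous_on_subset[OF weakly_convex_continuous[OF wc]]) auto
  then obtain B where B: "\<And>x. norm x \<le> R + 1 \<Longrightarrow> \<bar>J x\<bar> \<le> B"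
    using compact_imp_bounded bounded_iff
    by (metis image_eqI real_norm_def mem_cball_0)
  have "norm (w n) \<le> \<bar>2 * B + \<eta> / 2\<bar>" for n
  proof (cases "w n = 0")
    case False
    define x where "x = p n + w n /\<^sub>R norm (w n)"
    have "J (p n) + w n \<bullet> (x - p n) - \<eta> / 2 * (norm (x - p n))\<^sup>2 \<le> J x"
      using w by (auto simp: proximal_subgradient_def)
    moreover have "norm (x - p n) = 1" "w n \<bullet> (x - p n) = norm (w n)"
      using False by (simp_all add: x_def power2_norm_eq_inner[symmetric] power2_eq_square)
    moreover have "norm x \<le> R + 1"
      using norm_triangle_ineq[of "p n" "x - p n"] R[of n] \<open>norm (x - p n) = 1\<close> by simp
    ultimately show ?thesis using B[of x] B[of "p n"] R[of n] by simp
  qed simp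
  then show ?thesis by (auto simp: bounded_iff)
qed

section \<open>Frechet subgradients from smooth minorants\<close>

text \<open>The difference quotient of \<open>f\<close> dominates that of \<open>\<psi>\<close>,
  which tends to 0.\<close>

lemma frechet_subdifferential_minorant:
  fixes f \<psi> :: "'a::euclidean_space \<Rightarrow> real"
  assumes \<psi>: "(\<psi> has_derivative (\<lambda>d. v \<bullet> d)) (at x)" and le: "\<And>y. \<psi> y \<le> f y" and eq: "\<psi> x = f x"
  shows "v \<in> frechet_subdifferential (\<lambda>y. ereal (f y)) x"
proof -
  have lim: "((\<lambda>y. norm (\<psi> y - \<psi> x - v \<bullet> (y - x)) / norm (y - x)) \<longlongrightarrow> 0) (at x)"
    using \<psi> by (simp add: has_derivative_iff_norm)
  have "0 \<le> Liminf (at x) (\<lambda>y. (ereal (f y) - ereal (f x) - ereal (v \<bullet> (y - x))) / ereal (norm (y - x)))"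
  proof (subst le_Liminf_iff, intro allI impI)
    fix a :: ereal
    assume "a < 0"
    \<comment> \<open>\<open>a\<close> may be minus infinity; a real \<open>b\<close> between it and
      0 moves the estimate to the reals.\<close>
    then obtain b where b: "a < ereal b" "b < 0"
      by (metis ereal_dense2 ereal_less(2) zero_ereal_def less_ereal.simps(1))
    have "\<forall>\<^sub>F y in at x. norm (\<psi> y - \<psi> x - v \<bullet> (y - x)) / norm (y - x) < - b"
      using lim b(2) by (intro order_tendstoD) auto
    moreover have "\<forall>\<^sub>F y in at x. y \<noteq> x" by (rule eventually_at_filter[THEN iffD2]) simp
    ultimately show "\<forall>\<^sub>F y in at x.
        a < (ereal (f y) - ereal (f x) - ereal (v \<bullet> (y - x))) / ereal (norm (y - x))"
    proof eventually_elim
      case (elim y)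
      have pos: "norm (y - x) > 0" using elim(2) by simp
      have "\<bar>\<psi> y - \<psi> x - v \<bullet> (y - x)\<bar> < - b * norm (y - x)"
        using elim(1) pos by (simp add: field_simps)
      then have "b * norm (y - x) < f y - f x - v \<bullet> (y - x)" using le[of y] eq by linarith
      then have "b < (f y - f x - v \<bullet> (y - x)) / norm (y - x)" using pos by (simp add: field_simps)
      then have "ereal b < (ereal (f y) - ereal (f x) - ereal (v \<bullet> (y - x))) / ereal (norm (y - x))"
        using pos by simp
      with b(1) show ?case by (rule less_trans)
    qed
  qed
  then show ?thesis by (simp add: frechet_subdifferential_def)
qed

lemma frechet_subset_limiting: "frechet_subdifferential J x \<subseteq> limiting_subdifferential J x"
proof
  fix v
  assume v: "v \<in> frechet_subdifferential J x"
  then show "v \<in> limiting_subdifferential J x"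
    unfolding limiting_subdifferential_def
    by (intro CollectI conjI, simp add: frechet_subdifferential_def)
      (rule exI[of _ "\<lambda>_. x"], rule exI[of _ "\<lambda>_. v"], simp)
qed

section \<open>Calculus of continuously differentiable maps and gradients\<close>

lemma continuously_differentiable_on_compose:
  assumes "continuously_differentiable_on UNIV f" "continuously_differentiable_on UNIV g"
  shows "continuously_differentiable_on UNIV (g \<circ> f)"
proof -
  obtain f' g' where f: "\<And>x. (f has_derivative blinfun_apply (f' x)) (at x)" "continuous_on UNIV f'"
    and g: "\<And>x. (g has_derivative blinfun_apply (g' x)) (at x)" "continuous_on UNIV g'"
    using assms by (auto simp: continuously_differentiable_on_def)
  have "continuous_on UNIV f" using f(1) has_derivative_continuous by (blast intro: continuous_at_imp_continuous_on)
  then have "continuous_on UNIV (\<lambda>x. g' (f x))"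
    by (intro continuous_on_compose2[OF g(2)]) auto
  then have "continuous_on UNIV (\<lambda>x. g' (f x) o\<^sub>L f' x)"
    using f(2) by (intro bounded_bilinear.continuous_on[OF bounded_bilinear_blinfun_compose])
  moreover have "((g \<circ> f) has_derivative blinfun_apply (g' (f x) o\<^sub>L f' x)) (at x)" for x
    using diff_chain_at[OF f(1) g(1), of x] by (simp add: blinfun_compose.rep_eq)
  ultimately show ?thesis
    unfolding continuously_differentiable_on_def
    by (intro exI[of _ "\<lambda>x. g' (f x) o\<^sub>L f' x"]) simp
qed

lemma continuously_differentiable_on_const: "continuously_differentiable_on UNIV (\<lambda>x. c)"
  unfolding continuously_differentiable_on_def
  by (intro exI[of _ "\<lambda>_. 0"]) (auto simp: zero_blinfun.rep_eq)

text \<open>\<open>adjoint f' 1\<close> is the Riesz vector of the functional \<open>f'\<close>, so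
  the description in \<open>gradient\<close> is met.\<close>

lemma inner_gradient_eq:
  assumes "(f has_derivative f') (at x)"
  shows "gradient f x \<bullet> d = f' d"
proof -
  interpret bounded_linear f' using assms by (rule has_derivative_bounded_linear)
  have f': "f' = (\<lambda>d. d \<bullet> adjoint f' 1)"
    using adjoint_works[OF linear_axioms, of _ 1] by (simp add: fun_eq_iff)
  then have "GDERIV f x :> adjoint f' 1"
    using assms by (simp add: gderiv_def)
  then have "gradient f x = adjoint f' 1" by (rule gradient_eqI)
  then show ?thesis using f' by (metis inner_commute)
qed

section \<open>Cluster points of smoothed gradients\<close>

text \<open>The common core of both inclusions and the distance bound. The chain rule expresses the
  gradient through \<open>w n\<close> and derivatives continuous in \<open>y n\<close>, so a
  convergent subsequence of the bounded \<open>w\<close> makes the gradients converge too.\<close>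

lemma smoothed_gradients_cluster:
  fixes J :: "'z::euclidean_space \<Rightarrow> real" and G :: "'y::euclidean_space \<Rightarrow> 'z" and H :: "'y \<Rightarrow> real"
  assumes wc: "weakly_convex \<eta> J" and \<eta>: "\<eta> > 0"
    and G: "continuously_differentiable_on UNIV G" and H: "continuously_differentiable_on UNIV H"
    and y: "y \<longlonglongrightarrow> ybar" and \<mu>: "\<And>n. 0 < \<mu> n \<and> \<mu> n < inverse \<eta>" "\<mu> \<longlonglongrightarrow> 0"
  obtains r v where "strict_mono (r :: nat \<Rightarrow> nat)"
    "(\<lambda>n. gradient (\<lambda>u. H u + moreau_envelope (\<mu> (r n)) J (G u)) (y (r n))) \<longlonglongrightarrow> v"
    "v \<in> limiting_subdifferential (\<lambda>u. ereal (H u + J (G u))) ybar"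
proof -
  obtain G' H' where G': "\<And>x. (G has_derivative blinfun_apply (G' x)) (at x)" "continuous_on UNIV G'"
    and H': "\<And>x. (H has_derivative blinfun_apply (H' x)) (at x)" "continuous_on UNIV H'"
    using G H by (auto simp: continuously_differentiable_on_def)
  have "\<exists>p. prox_point (\<mu> n) J (G (y n)) p" for n
    using prox_point_exists[OF wc \<eta>, of "\<mu> n" "G (y n)"] \<mu>(1) by blast
  then obtain p where p: "\<And>n. prox_point (\<mu> n) J (G (y n)) (p n)" by metis
  define w where "w n = (G (y n) - p n) /\<^sub>R \<mu> n" for n
  define v where "v n = gradient (\<lambda>u. H u + moreau_envelope (\<mu> n) J (G u)) (y n)" for n
  have "isCont G ybar" using G'(1) by (rule has_derivative_continuous)
  then have "(\<lambda>n. G (y n)) \<longlonglongrightarrow> G ybar" using y by (rule isCont_tendsto_compose)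
  then have plim: "p \<longlonglongrightarrow> G ybar"
    using prox_points_converge[OF wc \<eta>, of \<mu> "\<lambda>n. G (y n)"] \<mu> p by blast
  have w: "proximal_subgradient \<eta> J (p n) (w n)" for n
    unfolding w_def using \<mu>(1) p by (intro prox_point_subgradient[OF wc]) auto
  obtain r w0 where r: "strict_mono (r :: nat \<Rightarrow> nat)" and "(w \<circ> r) \<longlonglongrightarrow> w0"
    using bounded_imp_convergent_subsequence[OF proximal_subgradients_bounded[OF wc plim w]] by blast
  then have wlim: "(\<lambda>n. w (r n)) \<longlonglongrightarrow> w0" by (simp add: o_def)
  have plim': "(\<lambda>n. p (r n)) \<longlonglongrightarrow> G ybar" using LIMSEQ_subseq_LIMSEQ[OF plim r] by (simp add: o_def)
  have ylim': "(\<lambda>n. y (r n)) \<longlonglongrightarrow> ybar" using LIMSEQ_subseq_LIMSEQ[OF y r] by (simp add: o_def)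
  have w0: "proximal_subgradient \<eta> J (G ybar) w0"
    unfolding proximal_subgradient_def
  proof
    fix x
    have "isCont J (G ybar)"
      using weakly_convex_continuous[OF wc] by (simp add: continuous_on_eq_continuous_at)
    then have "(\<lambda>n. J (p (r n))) \<longlonglongrightarrow> J (G ybar)" using plim' by (rule isCont_tendsto_compose)
    then have "(\<lambda>n. J (p (r n)) + w (r n) \<bullet> (x - p (r n)) - \<eta> / 2 * (norm (x - p (r n)))\<^sup>2)
        \<longlonglongrightarrow> J (G ybar) + w0 \<bullet> (x - G ybar) - \<eta> / 2 * (norm (x - G ybar))\<^sup>2"
      by (intro tendsto_intros wlim plim')
    then show "J (G ybar) + w0 \<bullet> (x - G ybar) - \<eta> / 2 * (norm (x - G ybar))\<^sup>2 \<le> J x"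
      by (rule LIMSEQ_le_const2) (use w in \<open>auto simp: proximal_subgradient_def\<close>)
  qed
  have v: "v n \<bullet> d = H' (y n) d + w n \<bullet> G' (y n) d" for n d
  proof -
    have "(moreau_envelope (\<mu> n) J has_derivative (\<lambda>d. w n \<bullet> d)) (at (G (y n)))"
      unfolding w_def using \<mu>(1) p by (intro moreau_envelope_has_derivative[OF wc \<eta>]) auto
    from has_derivative_compose[OF G'(1) this]
    have "((\<lambda>u. H u + moreau_envelope (\<mu> n) J (G u)) has_derivative (\<lambda>d. H' (y n) d + w n \<bullet> G' (y n) d)) (at (y n))"
      by (intro has_derivative_add H'(1))
    then show ?thesis unfolding v_def by (rule inner_gradient_eq)
  qed
  \<comment> \<open>Built from coordinates, so that convergence to \<open>v0\<close> follows
    termwise from that of \<open>w\<close>, \<open>G'\<close> and \<open>H'\<close>.\<close>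
  define v0 where "v0 = (\<Sum>b\<in>Basis. (H' ybar b + w0 \<bullet> G' ybar b) *\<^sub>R b)"
  have G'lim: "(\<lambda>n. G' (y (r n))) \<longlonglongrightarrow> G' ybar"
    by (rule isCont_tendsto_compose[OF _ ylim']) (use G'(2) in \<open>simp add: continuous_on_eq_continuous_at\<close>)
  have H'lim: "(\<lambda>n. H' (y (r n))) \<longlonglongrightarrow> H' ybar"
    by (rule isCont_tendsto_compose[OF _ ylim']) (use H'(2) in \<open>simp add: continuous_on_eq_continuous_at\<close>)
  have "(\<lambda>n. \<Sum>b\<in>Basis. (H' (y (r n)) b + w (r n) \<bullet> G' (y (r n)) b) *\<^sub>R b) \<longlonglongrightarrow> v0"
    unfolding v0_def by (intro tendsto_intros wlim G'lim H'lim)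
  then have vlim: "(\<lambda>n. v (r n)) \<longlonglongrightarrow> v0"
    by (simp add: v[symmetric] euclidean_representation)
  have v0: "v0 \<bullet> d = H' ybar d + w0 \<bullet> G' ybar d" for d
  proof (rule LIMSEQ_unique)
    show "(\<lambda>n. v (r n) \<bullet> d) \<longlonglongrightarrow> v0 \<bullet> d" by (intro tendsto_intros vlim)
    show "(\<lambda>n. v (r n) \<bullet> d) \<longlonglongrightarrow> H' ybar d + w0 \<bullet> G' ybar d"
      unfolding v by (intro tendsto_intros wlim G'lim H'lim)
  qed
  \<comment> \<open>The quadratic minorant of \<open>J\<close> at \<open>G ybar\<close>, composed
    with \<open>G\<close>. The square is an inner product because \<open>norm\<close> is not
    differentiable at 0; its derivative vanishes at \<open>ybar\<close>.\<close>
  define \<psi> where "\<psi> u = H u + (J (G ybar) + w0 \<bullet> (G u - G ybar)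
      - \<eta> / 2 * ((G u - G ybar) \<bullet> (G u - G ybar)))" for u
  have "(\<psi> has_derivative (\<lambda>d. v0 \<bullet> d)) (at ybar)"
    unfolding \<psi>_def v0 by (rule derivative_eq_intros G'(1) H'(1) refl)+ simp
  then have "v0 \<in> frechet_subdifferential (\<lambda>u. ereal (H u + J (G u))) ybar"
    using w0 by (elim frechet_subdifferential_minorant)
      (auto simp: \<psi>_def proximal_subgradient_def power2_norm_eq_inner)
  then have "v0 \<in> limiting_subdifferential (\<lambda>u. ereal (H u + J (G u))) ybar"
    using frechet_subset_limiting by blast
  with r vlim show thesis unfolding v_def by (rule that)
qed

section \<open>The inclusions and the distance bound\<close>

lemma outer_limit_smoothed_gradients:
  fixes J :: "'z::euclidean_space \<Rightarrow> real" and G :: "'y::euclidean_space \<Rightarrow> 'z" and H :: "'y \<Rightarrow> real"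
  assumes wc: "weakly_convex \<eta> J" and \<eta>: "\<eta> > 0"
    and G: "continuously_differentiable_on UNIV G" and H: "continuously_differentiable_on UNIV H"
  shows "outer_limit \<eta> (\<lambda>\<mu>. gradient (\<lambda>u. H u + moreau_envelope \<mu> J (G u))) ybar
    \<subseteq> limiting_subdifferential (\<lambda>u. ereal (H u + J (G u))) ybar"
proof
  fix v
  assume "v \<in> outer_limit \<eta> (\<lambda>\<mu>. gradient (\<lambda>u. H u + moreau_envelope \<mu> J (G u))) ybar"
  then obtain y \<mu> where y: "y \<longlonglongrightarrow> ybar" and \<mu>: "smoothing_parameters \<eta> \<mu>"
    and v: "(\<lambda>n. gradient (\<lambda>u. H u + moreau_envelope (\<mu> n) J (G u)) (y n)) \<longlonglongrightarrow> v"
    by (auto simp: outer_limit_def)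
  from \<mu> have "\<And>n. 0 < \<mu> n \<and> \<mu> n < inverse \<eta>" "\<mu> \<longlonglongrightarrow> 0" by (auto simp: smoothing_parameters_def)
  then obtain r v' where r: "strict_mono (r :: nat \<Rightarrow> nat)"
    and v': "(\<lambda>n. gradient (\<lambda>u. H u + moreau_envelope (\<mu> (r n)) J (G u)) (y (r n))) \<longlonglongrightarrow> v'"
      "v' \<in> limiting_subdifferential (\<lambda>u. ereal (H u + J (G u))) ybar"
    by (rule smoothed_gradients_cluster[OF wc \<eta> G H y])
  have "(\<lambda>n. gradient (\<lambda>u. H u + moreau_envelope (\<mu> (r n)) J (G u)) (y (r n))) \<longlonglongrightarrow> v"
    using LIMSEQ_subseq_LIMSEQ[OF v r] by (simp add: o_def)
  with v' show "v \<in> limiting_subdifferential (\<lambda>u. ereal (H u + J (G u))) ybar"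
    using LIMSEQ_unique by blast
qed

lemma ext_dist_le_liminf_smoothed_gradients:
  fixes J :: "'z::euclidean_space \<Rightarrow> real" and G :: "'y::euclidean_space \<Rightarrow> 'z" and H :: "'y \<Rightarrow> real"
  assumes wc: "weakly_convex \<eta> J" and \<eta>: "\<eta> > 0"
    and G: "continuously_differentiable_on UNIV G" and H: "continuously_differentiable_on UNIV H"
    and y: "y \<longlonglongrightarrow> ybar" and \<mu>: "smoothing_parameters \<eta> \<mu>"
  shows "ext_dist 0 (limiting_subdifferential (\<lambda>u. ereal (H u + J (G u))) ybar)
    \<le> liminf (\<lambda>n. ereal (norm (gradient (\<lambda>u. H u + moreau_envelope (\<mu> n) J (G u)) (y n))))"
proof -
  let ?N = "\<lambda>n. ereal (norm (gradient (\<lambda>u. H u + moreau_envelope (\<mu> n) J (G u)) (y n)))"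
  \<comment> \<open>Two extractions: \<open>s\<close> realises the liminf, and \<open>r\<close> then
    makes the gradients themselves converge, which forces the liminf to be the real number
    \<open>norm v\<close>.\<close>
  obtain s where s: "strict_mono (s :: nat \<Rightarrow> nat)" "(?N \<circ> s) \<longlonglongrightarrow> liminf ?N"
    using liminf_subseq_lim[of ?N] by blast
  have ys: "(\<lambda>n. y (s n)) \<longlonglongrightarrow> ybar" using LIMSEQ_subseq_LIMSEQ[OF y s(1)] by (simp add: o_def)
  have "\<And>n. 0 < \<mu> (s n) \<and> \<mu> (s n) < inverse \<eta>" "(\<lambda>n. \<mu> (s n)) \<longlonglongrightarrow> 0"
    using \<mu> LIMSEQ_subseq_LIMSEQ[OF _ s(1), of \<mu> 0] by (auto simp: smoothing_parameters_def o_def)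
  then obtain r v where r: "strict_mono (r :: nat \<Rightarrow> nat)"
    and v: "(\<lambda>n. gradient (\<lambda>u. H u + moreau_envelope (\<mu> (s (r n))) J (G u)) (y (s (r n)))) \<longlonglongrightarrow> v"
      "v \<in> limiting_subdifferential (\<lambda>u. ereal (H u + J (G u))) ybar"
    by (rule smoothed_gradients_cluster[OF wc \<eta> G H ys])
  have "(\<lambda>n. ?N (s (r n))) \<longlonglongrightarrow> ereal (norm v)" using v(1) by (intro tendsto_intros)
  moreover have "(\<lambda>n. ?N (s (r n))) \<longlonglongrightarrow> liminf ?N"
    using LIMSEQ_subseq_LIMSEQ[OF s(2) r] by (simp add: o_def)
  ultimately have "liminf ?N = ereal (norm v)" by (rule LIMSEQ_unique[symmetric])
  moreover have "ext_dist 0 (limiting_subdifferential (\<lambda>u. ereal (H u + J (G u))) ybar) \<le> ereal (norm (v - 0))"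
    unfolding ext_dist_def using v(2) by (rule INF_lower)
  ultimately show ?thesis by simp
qed

theorem theorem4p4:
  shows
  "(\<forall>(J :: 'z::euclidean_space \<Rightarrow> real) (\<eta> :: real) (F :: 'y::euclidean_space \<Rightarrow> 'z).
      \<eta> > 0 \<and> weakly_convex \<eta> J \<and> continuously_differentiable_on UNIV F \<longrightarrow>
      (\<forall>ybar. outer_limit \<eta> (\<lambda>\<mu>. gradient (moreau_envelope \<mu> J \<circ> F)) ybar
                \<subseteq> limiting_subdifferential (\<lambda>y. ereal ((J \<circ> F) y)) ybar))
   \<and>
   (\<forall>(C :: 'x::euclidean_space set) (h :: 'x \<Rightarrow> real) (S :: 'x \<Rightarrow> 'z) (g :: 'z \<Rightarrow> real)
       (F :: 'x \<Rightarrow> real) (F\<mu> :: real \<Rightarrow> 'x \<Rightarrow> real) (\<phi> :: 'y \<Rightarrow> 'x)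
       (L\<^sub>h :: real) (L\<^sub>g :: real) (\<eta> :: real).
      C \<noteq> {} \<and> connected C \<and> closed C \<and> (\<exists>d. embedded_submanifold d C) \<and>
      continuously_differentiable_on UNIV h \<and> L\<^sub>h > 0 \<and> L\<^sub>h-lipschitz_on C (gradient h) \<and>
      continuously_differentiable_on UNIV S \<and>
      L\<^sub>g > 0 \<and> L\<^sub>g-lipschitz_on UNIV g \<and> \<eta> > 0 \<and> weakly_convex \<eta> g \<and>
      F = (\<lambda>x. h x + (g \<circ> S) x) \<and>
      bdd_below (F ` C) \<and>
      continuously_differentiable_on UNIV \<phi> \<and> range \<phi> = C \<and>
      F\<mu> = (\<lambda>\<mu> x. h x + (moreau_envelope \<mu> g \<circ> S) x) \<longrightarrow>
      (\<forall>ybar. outer_limit \<eta> (\<lambda>\<mu>. gradient (F\<mu> \<mu> \<circ> \<phi>)) ybar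
                \<subseteq> limiting_subdifferential (\<lambda>y. ereal ((F \<circ> \<phi>) y)) ybar) \<and>
      (\<forall>(y :: nat \<Rightarrow> 'y) ybar (\<mu> :: nat \<Rightarrow> real).
         y \<longlonglongrightarrow> ybar \<and> smoothing_parameters \<eta> \<mu> \<longrightarrow>
         ext_dist 0 (limiting_subdifferential (\<lambda>y. ereal ((F \<circ> \<phi>) y)) ybar)
           \<le> liminf (\<lambda>n. ereal (norm (gradient (F\<mu> (\<mu> n) \<circ> \<phi>) (y n))))))"
proof (intro conjI allI impI; elim conjE)
  fix J :: "'z \<Rightarrow> real" and \<eta> and F :: "'y \<Rightarrow> 'z" and ybar
  assume "\<eta> > 0" "weakly_convex \<eta> J" "continuously_differentiable_on UNIV F"
  then show "outer_limit \<eta> (\<lambda>\<mu>. gradient (moreau_envelope \<mu> J \<circ> F)) ybar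
      \<subseteq> limiting_subdifferential (\<lambda>y. ereal ((J \<circ> F) y)) ybar"
    \<comment> \<open>A zero smooth part reduces the sum to the pure composition.\<close>
    using outer_limit_smoothed_gradients[of \<eta> J F "\<lambda>_. 0" ybar]
    by (simp add: o_def continuously_differentiable_on_const)
next
  fix h :: "'x \<Rightarrow> real" and S :: "'x \<Rightarrow> 'z" and g :: "'z \<Rightarrow> real" and F :: "'x \<Rightarrow> real" and F\<mu>
    and \<phi> :: "'y \<Rightarrow> 'x" and \<eta> ybar
  assume *: "continuously_differentiable_on UNIV h" "continuously_differentiable_on UNIV S"
    "\<eta> > 0" "weakly_convex \<eta> g" "continuously_differentiable_on UNIV \<phi>"
    and F: "F = (\<lambda>x. h x + (g \<circ> S) x)" "F\<mu> = (\<lambda>\<mu> x. h x + (moreau_envelope \<mu> g \<circ> S) x)"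
  show "outer_limit \<eta> (\<lambda>\<mu>. gradient (F\<mu> \<mu> \<circ> \<phi>)) ybar
      \<subseteq> limiting_subdifferential (\<lambda>y. ereal ((F \<circ> \<phi>) y)) ybar"
    \<comment> \<open>Along \<open>\<phi>\<close> the objective splits into the smooth part
      \<open>h \<circ> \<phi>\<close> and \<open>g\<close> after the smooth map
      \<open>S \<circ> \<phi>\<close>.\<close>
    using outer_limit_smoothed_gradients[of \<eta> g "S \<circ> \<phi>" "h \<circ> \<phi>" ybar] *
    by (simp add: F o_def continuously_differentiable_on_compose[unfolded o_def])
next
  fix h :: "'x \<Rightarrow> real" and S :: "'x \<Rightarrow> 'z" and g :: "'z \<Rightarrow> real" and F :: "'x \<Rightarrow> real" and F\<mu>
    and \<phi> :: "'y \<Rightarrow> 'x" and \<eta> ybar and y :: "nat \<Rightarrow> 'y" and \<mu> :: "nat \<Rightarrow> real"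
  assume *: "continuously_differentiable_on UNIV h" "continuously_differentiable_on UNIV S"
    "\<eta> > 0" "weakly_convex \<eta> g" "continuously_differentiable_on UNIV \<phi>"
    "y \<longlonglongrightarrow> ybar" "smoothing_parameters \<eta> \<mu>"
    and F: "F = (\<lambda>x. h x + (g \<circ> S) x)" "F\<mu> = (\<lambda>\<mu> x. h x + (moreau_envelope \<mu> g \<circ> S) x)"
  show "ext_dist 0 (limiting_subdifferential (\<lambda>y. ereal ((F \<circ> \<phi>) y)) ybar)
      \<le> liminf (\<lambda>n. ereal (norm (gradient (F\<mu> (\<mu> n) \<circ> \<phi>) (y n))))"
    using ext_dist_le_liminf_smoothed_gradients[of \<eta> g "S \<circ> \<phi>" "h \<circ> \<phi>" y ybar \<mu>] *
    by (simp add: F o_def continuously_differentiable_on_compose[unfolded o_def])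
qed

end
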